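(* For every two infinite compact spaces $K$ and $L$, their product $K\times L$ has the finitely supported Josefson--Nissenzweig property.
   Context: All compact spaces are Hausdorff. A compact space $M$ has the finitely supported Josefson--Nissenzweig property (fsJNP) if there is a sequence $\langle\mu_n\colon n\in\omega\rangle$ of finitely supported signed Radon measures on $M$ such that $\|\mu_n\|=1$ (total variation norm) for all $n\in\omega$ and $\lim_n\int_M f\,d\mu_n=0$ for every continuous $f\colon M\to\mathbb{R}$. *)

theory Defs
  imports "HOL-Analysis.Analysis"
begin

definition borel_sets :: "'a topology \<Rightarrow> 'a set set" where
  "borel_sets X = sigma_sets (topspace X) {U. openin X U}"

(* A signed measure is a real-valued set function, of which only the values on Borel sets
   matter. Being real-valued on the whole space, it automatically has finite variation. *)
definition signed_borel_measure :: "'a topology \<Rightarrow> ('a set \<Rightarrow> real) \<Rightarrow> bool" where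
  "signed_borel_measure X \<mu> \<longleftrightarrow>
     \<mu> {} = 0 \<and>
     (\<forall>A :: nat \<Rightarrow> 'a set. range A \<subseteq> borel_sets X \<longrightarrow> disjoint_family A \<longrightarrow>
        (\<lambda>n. \<mu> (A n)) sums \<mu> (\<Union>n. A n))"

(* Jordan decomposition \<mu> = \<mu>+ - \<mu>-, where \<mu>+(A) = sup {\<mu>(B) : B \<subseteq> A Borel} and \<mu>- = (-\<mu>)+.
   Truncation by ennreal at 0 is harmless since B = {} is admitted in the supremum. *)
definition pos_variation :: "'a topology \<Rightarrow> ('a set \<Rightarrow> real) \<Rightarrow> 'a set \<Rightarrow> ennreal" where
  "pos_variation X \<mu> A = (SUP B \<in> {B \<in> borel_sets X. B \<subseteq> A}. ennreal (\<mu> B))"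

definition neg_variation :: "'a topology \<Rightarrow> ('a set \<Rightarrow> real) \<Rightarrow> 'a set \<Rightarrow> ennreal" where
  "neg_variation X \<mu> = pos_variation X (\<lambda>A. - \<mu> A)"

definition total_variation :: "'a topology \<Rightarrow> ('a set \<Rightarrow> real) \<Rightarrow> 'a set \<Rightarrow> ennreal" where
  "total_variation X \<mu> A = pos_variation X \<mu> A + neg_variation X \<mu> A"

definition total_variation_norm :: "'a topology \<Rightarrow> ('a set \<Rightarrow> real) \<Rightarrow> ennreal" where
  "total_variation_norm X \<mu> = total_variation X \<mu> (topspace X)"

definition pos_part_measure :: "'a topology \<Rightarrow> ('a set \<Rightarrow> real) \<Rightarrow> 'a measure" where
  "pos_part_measure X \<mu> = measure_of (topspace X) (borel_sets X) (pos_variation X \<mu>)"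

definition neg_part_measure :: "'a topology \<Rightarrow> ('a set \<Rightarrow> real) \<Rightarrow> 'a measure" where
  "neg_part_measure X \<mu> = measure_of (topspace X) (borel_sets X) (neg_variation X \<mu>)"

definition signed_integral :: "'a topology \<Rightarrow> ('a set \<Rightarrow> real) \<Rightarrow> ('a \<Rightarrow> real) \<Rightarrow> real" where
  "signed_integral X \<mu> f =
     integral\<^sup>L (pos_part_measure X \<mu>) f - integral\<^sup>L (neg_part_measure X \<mu>) f"

definition signed_radon_measure :: "'a topology \<Rightarrow> ('a set \<Rightarrow> real) \<Rightarrow> bool" where
  "signed_radon_measure X \<mu> \<longleftrightarrow>
     signed_borel_measure X \<mu> \<and>
     (\<forall>A \<in> borel_sets X.
        total_variation X \<mu> A = (SUP C \<in> {C. compactin X C \<and> C \<subseteq> A}. total_variation X \<mu> C))"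

definition measure_support :: "'a topology \<Rightarrow> ('a set \<Rightarrow> real) \<Rightarrow> 'a set" where
  "measure_support X \<mu> =
     {x \<in> topspace X. \<forall>U. openin X U \<longrightarrow> x \<in> U \<longrightarrow> total_variation X \<mu> U > 0}"

(* For a Radon measure finiteness of the support means that |\<mu>| is concentrated on a finite
   set, i.e. that \<mu> is a finite linear combination of point masses. *)
definition finitely_supported :: "'a topology \<Rightarrow> ('a set \<Rightarrow> real) \<Rightarrow> bool" where
  "finitely_supported X \<mu> \<longleftrightarrow> finite (measure_support X \<mu>)"

definition fsJNP :: "'a topology \<Rightarrow> bool" where
  "fsJNP X \<longleftrightarrow>
     (\<exists>\<mu> :: nat \<Rightarrow> 'a set \<Rightarrow> real.
        (\<forall>n. signed_radon_measure X (\<mu> n) \<and> finitely_supported X (\<mu> n)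
             \<and> total_variation_norm X (\<mu> n) = 1) \<and>
        (\<forall>f. continuous_map X euclideanreal f \<longrightarrow>
             (\<lambda>n. signed_integral X (\<mu> n) f) \<longlonglongrightarrow> 0))"

end

theory Submission
  imports Defs "HOL-Library.Nat_Bijection"
begin

text \<open>
  Index the rows of a matrix by all sign vectors of length \<open>n\<close> and its columns by the \<open>n\<close>
  coordinates, and let the entry at \<open>(s, i)\<close> be \<open>s\<^sub>i / (n 2\<^sup>n)\<close>.  As \<open>K\<close> and \<open>L\<close> are infinite,
  there are distinct points \<open>x\<^sub>s\<close> in \<open>K\<close> for the rows and distinct points \<open>y\<^sub>i\<close> in \<open>L\<close> for the
  columns.  Placing the entries as point masses at \<open>(x\<^sub>s, y\<^sub>i)\<close> gives a finitely supported
  measure \<open>\<mu>\<^sub>n\<close>, and its norm is 1 because the \<open>n 2\<^sup>n\<close> entries have equal modulus.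

  The integral of \<open>f\<close> against \<open>\<mu>\<^sub>n\<close> is the average over all sign vectors \<open>s\<close> of
  \<open>(1/n) \<Sum>\<^sub>i s\<^sub>i f(x\<^sub>s, y\<^sub>i)\<close>.  If \<open>f(x\<^sub>s, \<sqdot>)\<close> did not depend on \<open>s\<close>, this would be small:
  independent signs give \<open>\<Sum>\<^sub>i s\<^sub>i a\<^sub>i\<close> a mean square of \<open>\<Sum>\<^sub>i a\<^sub>i\<^sup>2\<close>, so its mean modulus is only of
  order \<open>\<surd>n\<close> (\<open>sum_signs_first_moment\<close>).  In general the row may choose its function \<open>f(x\<^sub>s, \<sqdot>)\<close>
  in dependence on \<open>s\<close>, but compactness leaves it, up to an error \<open>\<epsilon>\<close>, a choice from a finite
  list that is the same for all \<open>n\<close> (\<open>finitely_many_sections_dense\<close>).  Bounding each row by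
  the sum over the whole list costs a constant factor, and the integral is at most
  \<open>\<epsilon> + O(1/\<surd>n)\<close> (\<open>sign_matrix_average_bound\<close>).

  The Hausdorff property makes finite sets closed and hence Borel.  This identifies the variations
  of \<open>\<mu>\<^sub>n\<close> and the integrals against it as finite sums (\<open>total_variation_atomic\<close>,
  \<open>signed_integral_atomic\<close>).
\<close>

section \<open>Signed measures with finitely many atoms\<close>

text \<open>
  The atoms are given as an indexed family rather than as a weight on points, so that sums over
  atoms are sums over the index set; the family is assumed injective where it matters that masses
  do not cancel.
\<close>

definition atomic_measure :: "'i set \<Rightarrow> ('i \<Rightarrow> 'a) \<Rightarrow> ('i \<Rightarrow> real) \<Rightarrow> 'a set \<Rightarrow> real" where
  "atomic_measure I p c A = (\<Sum>i\<in>I. c i * indicator A (p i))"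

lemma finite_in_borel_sets:
  assumes "t1_space X" "finite B" "B \<subseteq> topspace X"
  shows "B \<in> borel_sets X"
proof -
  have "openin X (topspace X - B)"
    using assms t1_space_closedin_finite by blast
  hence "topspace X - (topspace X - B) \<in> borel_sets X"
    unfolding borel_sets_def by (intro sigma_sets.Compl sigma_sets.Basic) auto
  thus ?thesis
    using assms by (simp add: double_diff)
qed

lemma sums_indicator_disjoint:
  assumes "disjoint_family A"
  shows "(\<lambda>n. indicator (A n) x :: real) sums indicator (\<Union>n. A n) x"
proof (cases "x \<in> (\<Union>n. A n)")
  case True
  then obtain m where m: "x \<in> A m" by blast
  have "indicator (A n) x = (if n = m then 1 else 0 :: real)" for n
    using m assms by (auto simp: indicator_def disjoint_family_on_def)
  thus ?thesis
    using True sums_single[of m "\<lambda>_. 1::real"] by (simp add: indicator_def)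
next
  case False
  thus ?thesis by (simp add: indicator_def)
qed

lemma signed_borel_measure_atomic:
  "signed_borel_measure X (atomic_measure I p c)"
  unfolding signed_borel_measure_def atomic_measure_def
  by (auto intro!: sums_sum sums_mult sums_indicator_disjoint)

text \<open>
  The supremum that defines the positive variation is attained at the finite, hence Borel, set of
  the atoms in \<open>A\<close> with positive mass.
\<close>

lemma pos_variation_atomic:
  assumes "t1_space X" "finite I" "inj_on p I" "p ` I \<subseteq> topspace X"
  shows "pos_variation X (atomic_measure I p c) A = ennreal (atomic_measure I p (\<lambda>i. max 0 (c i)) A)"
  unfolding pos_variation_def
proof (rule antisym)
  show "(SUP B\<in>{B \<in> borel_sets X. B \<subseteq> A}. ennreal (atomic_measure I p c B))
        \<le> ennreal (atomic_measure I p (\<lambda>i. max 0 (c i)) A)"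
    by (intro SUP_least ennreal_leI) (auto simp: atomic_measure_def indicator_def intro!: sum_mono)
  let ?B = "p ` {i\<in>I. 0 < c i} \<inter> A"
  have B: "?B \<in> borel_sets X"
    by (rule finite_in_borel_sets) (use assms in auto)
  have "atomic_measure I p c ?B = atomic_measure I p (\<lambda>i. max 0 (c i)) A"
    unfolding atomic_measure_def
    by (rule sum.cong) (use assms(3) in \<open>auto simp: indicator_def inj_on_def\<close>)
  thus "ennreal (atomic_measure I p (\<lambda>i. max 0 (c i)) A)
        \<le> (SUP B\<in>{B \<in> borel_sets X. B \<subseteq> A}. ennreal (atomic_measure I p c B))"
    by (intro SUP_upper2[of ?B]) (use B in auto)
qed

lemma neg_variation_atomic:
  assumes "t1_space X" "finite I" "inj_on p I" "p ` I \<subseteq> topspace X"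
  shows "neg_variation X (atomic_measure I p c) A = ennreal (atomic_measure I p (\<lambda>i. max 0 (- c i)) A)"
proof -
  have "(\<lambda>A. - atomic_measure I p c A) = atomic_measure I p (\<lambda>i. - c i)"
    by (simp add: atomic_measure_def fun_eq_iff sum_negf)
  thus ?thesis
    unfolding neg_variation_def using pos_variation_atomic[OF assms] by simp
qed

lemma total_variation_atomic:
  assumes "t1_space X" "finite I" "inj_on p I" "p ` I \<subseteq> topspace X"
  shows "total_variation X (atomic_measure I p c) A = ennreal (atomic_measure I p (\<lambda>i. \<bar>c i\<bar>) A)"
proof -
  have "atomic_measure I p (\<lambda>i. max 0 (c i)) A + atomic_measure I p (\<lambda>i. max 0 (- c i)) A
        = atomic_measure I p (\<lambda>i. \<bar>c i\<bar>) A"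
    unfolding atomic_measure_def sum.distrib[symmetric]
    by (rule sum.cong) (auto simp: indicator_def)
  moreover have "0 \<le> atomic_measure I p (\<lambda>i. max 0 (d i)) A" for d
    by (simp add: atomic_measure_def sum_nonneg)
  ultimately show ?thesis
    unfolding total_variation_def pos_variation_atomic[OF assms] neg_variation_atomic[OF assms]
    by (metis ennreal_plus)
qed

text \<open>
  Inner regularity holds because the finite, hence compact, set of atoms in \<open>A\<close> already carries all
  of the total variation of \<open>A\<close>.
\<close>

lemma signed_radon_measure_atomic:
  assumes "t1_space X" "finite I" "inj_on p I" "p ` I \<subseteq> topspace X"
  shows "signed_radon_measure X (atomic_measure I p c)"
  unfolding signed_radon_measure_def total_variation_atomic[OF assms]
proof (intro conjI ballI antisym)
  show "signed_borel_measure X (atomic_measure I p c)"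
    by (rule signed_borel_measure_atomic)
  fix A
  let ?\<nu> = "\<lambda>C. ennreal (atomic_measure I p (\<lambda>i. \<bar>c i\<bar>) C)"
  show "(SUP C\<in>{C. compactin X C \<and> C \<subseteq> A}. ?\<nu> C) \<le> ?\<nu> A"
    by (intro SUP_least ennreal_leI) (auto simp: atomic_measure_def indicator_def intro!: sum_mono)
  have "compactin X (p ` I \<inter> A)"
    by (rule finite_imp_compactin) (use assms in auto)
  moreover have "?\<nu> (p ` I \<inter> A) = ?\<nu> A"
    unfolding atomic_measure_def by (intro arg_cong[where f=ennreal] sum.cong) (auto simp: indicator_def)
  ultimately show "?\<nu> A \<le> (SUP C\<in>{C. compactin X C \<and> C \<subseteq> A}. ?\<nu> C)"
    by (intro SUP_upper2[of "p ` I \<inter> A"]) auto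
qed

text \<open>
  The complement of the atoms is an open set of variation zero, so it misses the support.
\<close>

lemma finitely_supported_atomic:
  assumes "t1_space X" "finite I" "inj_on p I" "p ` I \<subseteq> topspace X"
  shows "finitely_supported X (atomic_measure I p c)"
proof -
  have "closedin X (p ` I)"
    using assms by (simp add: t1_space_closedin_finite)
  hence "openin X (topspace X - p ` I)"
    by (simp add: closedin_def)
  moreover have "total_variation X (atomic_measure I p c) (topspace X - p ` I) = 0"
    unfolding total_variation_atomic[OF assms] by (simp add: atomic_measure_def)
  ultimately have "x \<in> p ` I" if "x \<in> measure_support X (atomic_measure I p c)" for x
    using that unfolding measure_support_def by (metis (mono_tags, lifting) DiffI less_irrefl mem_Collect_eq)
  hence "measure_support X (atomic_measure I p c) \<subseteq> p ` I"
    by blast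
  thus ?thesis
    unfolding finitely_supported_def using assms(2) finite_subset by blast
qed

lemma total_variation_norm_atomic:
  assumes "t1_space X" "finite I" "inj_on p I" "p ` I \<subseteq> topspace X"
  shows "total_variation_norm X (atomic_measure I p c) = ennreal (\<Sum>i\<in>I. \<bar>c i\<bar>)"
proof -
  have "atomic_measure I p (\<lambda>i. \<bar>c i\<bar>) (topspace X) = (\<Sum>i\<in>I. \<bar>c i\<bar>)"
    unfolding atomic_measure_def by (rule sum.cong) (use assms(4) in \<open>auto simp: indicator_def\<close>)
  thus ?thesis
    unfolding total_variation_norm_def total_variation_atomic[OF assms] by simp
qed

text \<open>
  The Borel measure with atoms \<open>p i\<close> is the image under \<open>p\<close> of a weighted counting measure on the
  index set, against which integrals are finite sums.
\<close>

lemma integral_atomic_nonneg: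
  assumes fin: "finite I" and p: "p ` I \<subseteq> topspace X" and d: "\<And>i. i \<in> I \<Longrightarrow> 0 \<le> d i"
    and f: "continuous_map X euclideanreal f"
  shows "integral\<^sup>L (measure_of (topspace X) (borel_sets X) (\<lambda>A. ennreal (atomic_measure I p d A))) f
         = (\<Sum>i\<in>I. d i * f (p i))"
proof -
  let ?N = "sigma (topspace X) {U. openin X U}"
  let ?P = "point_measure I d"
  have op: "{U. openin X U} \<subseteq> Pow (topspace X)"
    using openin_subset by blast
  have space: "space ?N = topspace X" and sets: "sets ?N = borel_sets X"
    using op by (simp_all add: borel_sets_def)
  have pmeas: "p \<in> measurable ?P ?N"
    using p space by auto
  have fmeas: "f \<in> borel_measurable ?N"
  proof (rule borel_measurableI)
    fix S :: "real set" assume "open S"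
    hence "openin X {x \<in> topspace X. f x \<in> S}"
      using f openin_continuous_map_preimage[of X euclideanreal f S] by simp
    moreover have "f -` S \<inter> space ?N = {x \<in> topspace X. f x \<in> S}"
      using space by auto
    ultimately show "f -` S \<inter> space ?N \<in> sets ?N"
      unfolding sets borel_sets_def by (simp add: sigma_sets.Basic)
  qed
  have em: "ennreal (atomic_measure I p d A) = emeasure ?P (p -` A \<inter> space ?P)" for A
  proof -
    have "emeasure ?P (p -` A \<inter> space ?P) = (\<Sum>i\<in>p -` A \<inter> I. ennreal (d i))"
      by (subst emeasure_point_measure_finite) (use fin in \<open>auto simp: space_point_measure\<close>)
    also have "\<dots> = ennreal (\<Sum>i\<in>p -` A \<inter> I. d i)"
      using d by (intro sum_ennreal) auto
    also have "(\<Sum>i\<in>p -` A \<inter> I. d i) = atomic_measure I p d A"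
      unfolding atomic_measure_def
      by (rule sum.mono_neutral_cong_left) (use fin in \<open>auto simp: indicator_def\<close>)
    finally show ?thesis by simp
  qed
  have "measure_of (topspace X) (borel_sets X) (\<lambda>A. ennreal (atomic_measure I p d A)) = distr ?P ?N p"
    unfolding distr_def space sets em ..
  hence "integral\<^sup>L (measure_of (topspace X) (borel_sets X) (\<lambda>A. ennreal (atomic_measure I p d A))) f
      = integral\<^sup>L ?P (\<lambda>i. f (p i))"
    using integral_distr[OF pmeas fmeas] by simp
  also have "\<dots> = (\<Sum>i\<in>I. d i * f (p i))"
    by (subst lebesgue_integral_point_measure_finite) (use fin d in auto)
  finally show ?thesis .
qed

lemma signed_integral_atomic:
  assumes "t1_space X" "finite I" "inj_on p I" "p ` I \<subseteq> topspace X"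
    and f: "continuous_map X euclideanreal f"
  shows "signed_integral X (atomic_measure I p c) f = (\<Sum>i\<in>I. c i * f (p i))"
proof -
  note atoms = assms(1-4)
  have "pos_variation X (atomic_measure I p c) = (\<lambda>A. ennreal (atomic_measure I p (\<lambda>i. max 0 (c i)) A))"
    "neg_variation X (atomic_measure I p c) = (\<lambda>A. ennreal (atomic_measure I p (\<lambda>i. max 0 (- c i)) A))"
    using pos_variation_atomic[OF atoms] neg_variation_atomic[OF atoms] by blast+
  hence "signed_integral X (atomic_measure I p c) f
      = (\<Sum>i\<in>I. max 0 (c i) * f (p i)) - (\<Sum>i\<in>I. max 0 (- c i) * f (p i))"
    unfolding signed_integral_def pos_part_measure_def neg_part_measure_def
    using assms(2,4) f by (simp add: integral_atomic_nonneg)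
  also have "\<dots> = (\<Sum>i\<in>I. c i * f (p i))"
    unfolding sum_subtractf[symmetric] by (rule sum.cong) (auto simp: max_def)
  finally show ?thesis .
qed

section \<open>Random signs\<close>

text \<open>
  A sign vector is encoded by the set of coordinates where it is \<open>1\<close>.  Sums over \<open>Pow I\<close>
  are then sums over all sign vectors with index set \<open>I\<close>.
\<close>

definition sign_of :: "'a set \<Rightarrow> 'a \<Rightarrow> real" where
  "sign_of S i = (if i \<in> S then 1 else - 1)"

lemma abs_sign_of [simp]: "\<bar>sign_of S i\<bar> = 1"
  by (simp add: sign_of_def)

text \<open>
  This is the orthogonality of the Rademacher functions.  In the induction, the two choices of the
  sign at the new coordinate turn a partial sum \<open>Z\<close> into \<open>Z - a x\<close> and \<open>Z + a x\<close>, and the mixed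
  terms of the squares cancel.
\<close>

lemma sum_signs_second_moment:
  assumes "finite I"
  shows "(\<Sum>S\<in>Pow I. (\<Sum>i\<in>I. sign_of S i * a i)\<^sup>2) = 2 ^ card I * (\<Sum>i\<in>I. (a i)\<^sup>2)"
  using assms
proof (induction I rule: finite_induct)
  case empty
  thus ?case by simp
next
  case (insert x F)
  let ?Z = "\<lambda>S. \<Sum>i\<in>F. sign_of S i * a i"
  have inj: "inj_on (insert x) (Pow F)"
    using insert.hyps by (auto simp: inj_on_def)
  have minus: "(\<Sum>i\<in>insert x F. sign_of S i * a i) = ?Z S - a x" if "S \<in> Pow F" for S
    using insert.hyps that by (auto simp: sign_of_def)
  have "?Z (insert x S) = ?Z S" for S
    by (rule sum.cong) (use insert.hyps in \<open>auto simp: sign_of_def\<close>)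
  hence plus: "(\<Sum>i\<in>insert x F. sign_of (insert x S) i * a i) = ?Z S + a x" for S
    using insert.hyps by (simp add: sign_of_def)
  have "(\<Sum>S\<in>Pow (insert x F). (\<Sum>i\<in>insert x F. sign_of S i * a i)\<^sup>2)
      = (\<Sum>S\<in>Pow F. (\<Sum>i\<in>insert x F. sign_of S i * a i)\<^sup>2)
        + (\<Sum>S\<in>Pow F. (\<Sum>i\<in>insert x F. sign_of (insert x S) i * a i)\<^sup>2)"
    unfolding Pow_insert using insert.hyps
    by (subst sum.union_disjoint) (auto simp: sum.reindex[OF inj])
  also have "\<dots> = (\<Sum>S\<in>Pow F. (?Z S - a x)\<^sup>2) + (\<Sum>S\<in>Pow F. (?Z S + a x)\<^sup>2)"
    by (simp only: plus minus cong: sum.cong)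
  also have "\<dots> = (\<Sum>S\<in>Pow F. 2 * (?Z S)\<^sup>2 + 2 * (a x)\<^sup>2)"
    unfolding sum.distrib[symmetric]
    by (rule sum.cong) (auto simp: power2_eq_square algebra_simps)
  also have "\<dots> = 2 * (\<Sum>S\<in>Pow F. (?Z S)\<^sup>2) + 2 ^ card F * (2 * (a x)\<^sup>2)"
    using insert.hyps by (simp add: sum.distrib sum_distrib_left card_Pow)
  finally show ?case
    using insert by (simp add: algebra_simps)
qed

text \<open>
  The bound \<open>M \<surd>n\<close> on the mean modulus, where trivially one has \<open>M n\<close>, is the gain that makes the
  integrals tend to zero.  It follows from the second moment by the Cauchy--Schwarz inequality.
\<close>

lemma sum_signs_first_moment:
  assumes fin: "finite I" and M: "\<And>i. i \<in> I \<Longrightarrow> \<bar>a i\<bar> \<le> M" "0 \<le> M"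
  shows "(\<Sum>S\<in>Pow I. \<bar>\<Sum>i\<in>I. sign_of S i * a i\<bar>) \<le> 2 ^ card I * (M * sqrt (card I))"
proof (rule power2_le_imp_le)
  have "(\<Sum>S\<in>Pow I. \<bar>\<Sum>i\<in>I. sign_of S i * a i\<bar>)\<^sup>2
      \<le> (\<Sum>S\<in>Pow I. \<bar>\<Sum>i\<in>I. sign_of S i * a i\<bar>\<^sup>2) * card (Pow I)"
    by (rule sum_squared_le_sum_of_squares)
  also have "\<dots> = (2 ^ card I * (\<Sum>i\<in>I. (a i)\<^sup>2)) * 2 ^ card I"
    using fin by (simp add: sum_signs_second_moment card_Pow)
  also have "\<dots> \<le> (2 ^ card I * (card I * M\<^sup>2)) * 2 ^ card I"
    using M by (intro mult_right_mono mult_left_mono sum_bounded_above)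
      (simp_all add: abs_le_square_iff[symmetric])
  also have "\<dots> = (2 ^ card I * (M * sqrt (card I)))\<^sup>2"
    by (simp add: power_mult_distrib power2_eq_square)
  finally show "(\<Sum>S\<in>Pow I. \<bar>\<Sum>i\<in>I. sign_of S i * a i\<bar>)\<^sup>2 \<le> (2 ^ card I * (M * sqrt (card I)))\<^sup>2" .
qed (use M in simp)

section \<open>Continuous functions on a product with compact factors\<close>

text \<open>
  The sections of \<open>f\<close> form a totally bounded set in the uniform norm: by the tube lemma, nearby
  points of \<open>K\<close> have uniformly close sections, and \<open>K\<close> is compact.
\<close>

lemma finitely_many_sections_dense:
  assumes K: "compact_space K" and L: "compact_space L"
    and f: "continuous_map (prod_topology K L) euclideanreal f" and e: "0 < e"
  obtains J where "finite J" "J \<subseteq> topspace K"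
    "\<And>x. x \<in> topspace K \<Longrightarrow> \<exists>c\<in>J. \<forall>y\<in>topspace L. \<bar>f (x, y) - f (c, y)\<bar> < e"
proof -
  have "\<exists>U. openin K U \<and> c \<in> U \<and> (\<forall>x\<in>U. \<forall>y\<in>topspace L. \<bar>f (x, y) - f (c, y)\<bar> < e)"
    if c: "c \<in> topspace K" for c
  proof -
    let ?g = "\<lambda>z. f z - f (c, snd z)"
    have "continuous_map (prod_topology K L) (prod_topology K L) (\<lambda>z. (c, snd z))"
      using c by (intro continuous_map_pairedI continuous_map_snd) auto
    from continuous_map_compose[OF this f]
    have "continuous_map (prod_topology K L) euclideanreal ?g"
      using f by (intro continuous_map_diff) (auto simp: o_def)
    from openin_continuous_map_preimage[OF this, of "{-e<..<e}"]
    have W: "openin (prod_topology K L) {z \<in> topspace (prod_topology K L). ?g z \<in> {-e<..<e}}"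
      by simp
    have "{c} \<times> topspace L \<subseteq> {z \<in> topspace (prod_topology K L). ?g z \<in> {-e<..<e}}"
      using c e by auto
    from tube_lemma_right[OF W _ c this] L obtain U V where UV: "openin K U" "c \<in> U" "topspace L \<subseteq> V"
      "U \<times> V \<subseteq> {z \<in> topspace (prod_topology K L). ?g z \<in> {-e<..<e}}"
      unfolding compact_space_def by blast
    have "\<bar>f (x, y) - f (c, y)\<bar> < e" if "x \<in> U" "y \<in> topspace L" for x y
    proof -
      have "(x, y) \<in> {z \<in> topspace (prod_topology K L). ?g z \<in> {-e<..<e}}"
        using UV that by blast
      thus ?thesis by auto
    qed
    with UV show ?thesis by blast
  qed
  then obtain U where U: "\<And>c. c \<in> topspace K \<Longrightarrow> openin K (U c) \<and> c \<in> U c \<and>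
      (\<forall>x\<in>U c. \<forall>y\<in>topspace L. \<bar>f (x, y) - f (c, y)\<bar> < e)"
    by metis
  have "\<exists>\<F>. finite \<F> \<and> \<F> \<subseteq> U ` topspace K \<and> topspace K \<subseteq> \<Union>\<F>"
    using K[unfolded compact_space_alt, rule_format, of "U ` topspace K"] U by blast
  then obtain J where "finite J" "J \<subseteq> topspace K" "topspace K \<subseteq> \<Union>(U ` J)"
    by (metis finite_subset_image)
  thus ?thesis
    using U by (intro that[of J]) (blast+)
qed

lemma continuous_map_compact_bounded:
  assumes "compact_space X" "continuous_map X euclideanreal f"
  obtains M where "0 \<le> M" "\<And>x. x \<in> topspace X \<Longrightarrow> \<bar>f x\<bar> \<le> M"
proof -
  have "compactin euclideanreal (f ` topspace X)"
    using assms image_compactin unfolding compact_space_def by blast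
  hence "bounded (f ` topspace X)"
    by (simp add: compact_imp_bounded)
  then obtain b where "\<And>x. x \<in> topspace X \<Longrightarrow> \<bar>f x\<bar> \<le> b"
    unfolding bounded_iff by auto
  thus ?thesis
    by (intro that[of "max 0 b"]) (auto simp: le_max_iff_disj)
qed

section \<open>The sign-matrix measures\<close>

text \<open>
  The row functions \<open>h S\<close> may depend on the signs \<open>S\<close>, even adversarially.  What saves the estimate is
  that they stay close to a finite list \<open>g c\<close>, \<open>c \<in> J\<close>, chosen independently of \<open>S\<close>: for each
  fixed \<open>c\<close> the signs average out, and there are only \<open>card J\<close> of them.
\<close>

lemma sign_matrix_average_bound:
  fixes h :: "'i set \<Rightarrow> 'i \<Rightarrow> real" and g :: "'c \<Rightarrow> 'i \<Rightarrow> real" and M e :: real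
  assumes I: "finite I" "I \<noteq> {}" and J: "finite J" and M: "0 \<le> M" and e: "0 \<le> e"
    and approx: "\<And>S. S \<in> Pow I \<Longrightarrow> \<exists>c\<in>J. \<forall>i\<in>I. \<bar>h S i - g c i\<bar> \<le> e"
    and bound: "\<And>c i. c \<in> J \<Longrightarrow> i \<in> I \<Longrightarrow> \<bar>g c i\<bar> \<le> M"
  shows "\<bar>\<Sum>(S, i)\<in>Pow I \<times> I. sign_of S i / (real (card I) * 2 ^ card I) * h S i\<bar>
         \<le> e + card J * M / sqrt (card I)"
proof -
  define n where "n = card I"
  have n: "0 < n" using I by (simp add: n_def card_gt_0_iff)
  have row: "\<bar>\<Sum>i\<in>I. sign_of S i * h S i\<bar> \<le> n * e + (\<Sum>c\<in>J. \<bar>\<Sum>i\<in>I. sign_of S i * g c i\<bar>)"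
    if "S \<in> Pow I" for S
  proof -
    obtain c where c: "c \<in> J" "\<And>i. i \<in> I \<Longrightarrow> \<bar>h S i - g c i\<bar> \<le> e"
      using approx[OF \<open>S \<in> Pow I\<close>] by blast
    have "(\<Sum>i\<in>I. sign_of S i * h S i)
        = (\<Sum>i\<in>I. sign_of S i * (h S i - g c i)) + (\<Sum>i\<in>I. sign_of S i * g c i)"
      unfolding sum.distrib[symmetric] by (simp add: algebra_simps)
    moreover have "\<bar>\<Sum>i\<in>I. sign_of S i * (h S i - g c i)\<bar> \<le> n * e"
      unfolding n_def using c(2)
      by (intro order.trans[OF sum_abs] sum_bounded_above) (simp add: abs_mult)
    moreover have "\<bar>\<Sum>i\<in>I. sign_of S i * g c i\<bar> \<le> (\<Sum>c\<in>J. \<bar>\<Sum>i\<in>I. sign_of S i * g c i\<bar>)"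
      using c(1) J by (intro member_le_sum) auto
    ultimately show ?thesis by linarith
  qed
  have "\<bar>\<Sum>S\<in>Pow I. \<Sum>i\<in>I. sign_of S i * h S i\<bar>
      \<le> (\<Sum>S\<in>Pow I. n * e + (\<Sum>c\<in>J. \<bar>\<Sum>i\<in>I. sign_of S i * g c i\<bar>))"
    using row by (rule order.trans[OF sum_abs sum_mono])
  also have "\<dots> = 2 ^ n * (n * e) + (\<Sum>c\<in>J. \<Sum>S\<in>Pow I. \<bar>\<Sum>i\<in>I. sign_of S i * g c i\<bar>)"
    using I by (simp add: sum.distrib card_Pow n_def sum.swap[of _ "Pow I" J])
  also have "\<dots> \<le> 2 ^ n * (n * e) + card J * (2 ^ n * (M * sqrt n))"
    unfolding n_def using I M bound by (intro add_left_mono sum_bounded_above sum_signs_first_moment)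
  finally have "\<bar>\<Sum>S\<in>Pow I. \<Sum>i\<in>I. sign_of S i * h S i\<bar> / (real n * 2 ^ n)
      \<le> (2 ^ n * (n * e) + card J * (2 ^ n * (M * sqrt n))) / (real n * 2 ^ n)"
    by (rule divide_right_mono) simp
  also have "\<dots> = e + card J * M * (sqrt n / n)"
    using n by (simp add: field_simps)
  also have "sqrt n / n = 1 / sqrt n"
    using n by (simp add: field_simps)
  finally have "\<bar>\<Sum>S\<in>Pow I. \<Sum>i\<in>I. sign_of S i * h S i\<bar> / (real n * 2 ^ n) \<le> e + card J * M / sqrt n"
    by simp
  moreover have "(\<Sum>(S, i)\<in>Pow I \<times> I. sign_of S i / (real n * 2 ^ n) * h S i)
      = (\<Sum>S\<in>Pow I. \<Sum>i\<in>I. sign_of S i * h S i) / (real n * 2 ^ n)"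
    by (simp add: sum.cartesian_product[symmetric] sum_divide_distrib)
  ultimately show ?thesis
    unfolding n_def[symmetric] by (simp add: abs_divide)
qed

text \<open>
  The index sets \<open>{..n}\<close> are never empty, which keeps the averages away from division by zero.
  The list \<open>J\<close> and the bound \<open>M\<close> depend on \<open>f\<close> and \<open>e\<close> only, so they are fixed while \<open>n\<close> grows.
\<close>

lemma sign_matrix_averages_tendsto_0:
  assumes K: "compact_space K" and L: "compact_space L"
    and f: "continuous_map (prod_topology K L) euclideanreal f"
    and x: "\<And>S. x S \<in> topspace K" and y: "\<And>i. y i \<in> topspace L"
  shows "(\<lambda>n. \<Sum>(S, i)\<in>Pow {..n} \<times> {..n}. sign_of S i / (real (card {..n}) * 2 ^ card {..n}) * f (x S, y i))
         \<longlonglongrightarrow> 0"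
proof (rule tendstoI)
  fix e :: real assume "0 < e"
  then obtain J where J: "finite J" "J \<subseteq> topspace K"
    "\<And>x. x \<in> topspace K \<Longrightarrow> \<exists>c\<in>J. \<forall>y\<in>topspace L. \<bar>f (x, y) - f (c, y)\<bar> < e / 2"
    using finitely_many_sections_dense[OF K L f, of "e / 2"] by auto
  obtain M where M: "0 \<le> M" "\<And>z. z \<in> topspace (prod_topology K L) \<Longrightarrow> \<bar>f z\<bar> \<le> M"
    using continuous_map_compact_bounded[OF _ f] K L by (auto simp: compact_space_prod_topology)
  have "(\<lambda>n. card J * M / sqrt (card {..n})) \<longlonglongrightarrow> 0"
    by (intro real_tendsto_divide_at_top[OF tendsto_const] filterlim_compose[OF sqrt_at_top]
        filterlim_compose[OF filterlim_real_sequentially]) (simp add: filterlim_Suc)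
  hence "eventually (\<lambda>n. card J * M / sqrt (card {..n}) < e / 2) sequentially"
    using \<open>0 < e\<close> by (intro order_tendstoD) auto
  thus "eventually (\<lambda>n. dist (\<Sum>(S, i)\<in>Pow {..n} \<times> {..n}.
      sign_of S i / (real (card {..n}) * 2 ^ card {..n}) * f (x S, y i)) 0 < e) sequentially"
  proof eventually_elim
    case (elim n)
    have "\<bar>\<Sum>(S, i)\<in>Pow {..n} \<times> {..n}. sign_of S i / (real (card {..n}) * 2 ^ card {..n}) * f (x S, y i)\<bar>
        \<le> e / 2 + card J * M / sqrt (card {..n})"
    proof (rule sign_matrix_average_bound[where g = "\<lambda>c i. f (c, y i)"])
      show "\<exists>c\<in>J. \<forall>i\<in>{..n}. \<bar>f (x S, y i) - f (c, y i)\<bar> \<le> e / 2" for S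
        using J(3)[OF x[of S]] y by (meson less_imp_le)
    qed (use J M y \<open>0 < e\<close> in auto)
    with elim show ?case unfolding dist_real_def diff_0_right by linarith
  qed
qed

theorem theorem11p3:
  fixes K :: "'a topology" and L :: "'b topology"
  assumes "compact_space K" and "Hausdorff_space K" and "infinite (topspace K)"
    and "compact_space L" and "Hausdorff_space L" and "infinite (topspace L)"
  shows "fsJNP (prod_topology K L)"
proof -
  let ?X = "prod_topology K L"
  obtain u :: "nat \<Rightarrow> 'a" where u: "inj u" "range u \<subseteq> topspace K"
    using infinite_countable_subset[OF assms(3)] by blast
  obtain y :: "nat \<Rightarrow> 'b" where y: "inj y" "range y \<subseteq> topspace L"
    using infinite_countable_subset[OF assms(6)] by blast
  \<comment> \<open>Coding finite sets as numbers turns one injective sequence into row points for all \<open>n\<close> at once.\<close>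
  define x where "x S = u (set_encode S)" for S
  define I where "I n = Pow {..n} \<times> {..n}" for n :: nat
  define p where "p = (\<lambda>(S, i). (x S, y i))"
  define c where "c n = (\<lambda>(S, i :: nat). sign_of S i / (real (card {..n}) * 2 ^ card {..n}))" for n :: nat
  define \<mu> where "\<mu> n = atomic_measure (I n) p (c n)" for n
  have X: "t1_space ?X"
    using assms by (simp add: Hausdorff_imp_t1_space Hausdorff_space_prod_topology)
  have I: "finite (I n)" for n
    by (simp add: I_def)
  have inj: "inj_on p (I n)" for n
    unfolding p_def x_def I_def
    by (rule inj_onI) (auto simp: inj_eq[OF u(1)] inj_eq[OF y(1)] set_encode_eq finite_subset[OF _ finite_atMost])
  have p: "p ` I n \<subseteq> topspace ?X" for n
    using u y by (auto simp: p_def x_def)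
  have norm: "(\<Sum>i\<in>I n. \<bar>c n i\<bar>) = 1" for n
  proof -
    have "(\<Sum>i\<in>I n. \<bar>c n i\<bar>) = (\<Sum>i\<in>I n. 1 / (real (card {..n}) * 2 ^ card {..n}))"
      by (rule sum.cong) (auto simp: c_def abs_divide)
    also have "\<dots> = real (Suc n * 2 ^ Suc n) / (real (Suc n) * 2 ^ Suc n)"
      by (simp add: I_def card_cartesian_product card_Pow algebra_simps)
    also have "\<dots> = 1"
      unfolding of_nat_mult of_nat_power of_nat_numeral by (rule divide_self) simp
    finally show ?thesis .
  qed
  have lim: "(\<lambda>n. signed_integral ?X (\<mu> n) f) \<longlonglongrightarrow> 0" if f: "continuous_map ?X euclideanreal f" for f
  proof -
    have "signed_integral ?X (\<mu> n) f
        = (\<Sum>(S, i)\<in>Pow {..n} \<times> {..n}. sign_of S i / (real (card {..n}) * 2 ^ card {..n}) * f (x S, y i))" for n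
      unfolding \<mu>_def signed_integral_atomic[OF X I inj p f]
      by (simp add: I_def c_def p_def case_prod_beta)
    moreover have "x S \<in> topspace K" "y i \<in> topspace L" for S i
      using u y by (auto simp: x_def)
    ultimately show ?thesis
      using sign_matrix_averages_tendsto_0[OF assms(1,4) f, of x y] by simp
  qed
  show ?thesis
    unfolding fsJNP_def
  proof (intro exI[of _ \<mu>] conjI allI impI lim)
    fix n
    show "signed_radon_measure ?X (\<mu> n)" "finitely_supported ?X (\<mu> n)"
      unfolding \<mu>_def by (intro signed_radon_measure_atomic finitely_supported_atomic X I inj p)+
    show "total_variation_norm ?X (\<mu> n) = 1"
      unfolding \<mu>_def total_variation_norm_atomic[OF X I inj p] norm by simp
  qed
qed

end
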